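(* Let $K\ge 1$ and $\varepsilon\in(0,1/2)$ be real numbers, and let $A$ be an additive set with energy $E(A)\ge |A|^3/K$. Then there is a subset $A'\subseteq A$ such that \[ |A'|\ge (1-\varepsilon)K^{-1/2}|A| \quad\text{and}\quad |A'-A'|\le 2^{33}\varepsilon^{-9}K^{4}|A'|. \]
   Context: An additive set is a nonempty finite subset of an abelian group. The energy $E(A)$ of an additive set $A$ is the number of quadruples $(a_1,a_2,a_3,a_4)\in A^4$ with $a_1+a_2=a_3+a_4$. For sets $X,Y$ in an abelian group, $X-Y=\{x-y\colon x\in X,\ y\in Y\}$. *)

theory Defs
  imports Complex_Main
begin

definition additive_set :: "'a::ab_group_add set \<Rightarrow> bool" where
  "additive_set A \<longleftrightarrow> finite A \<and> A \<noteq> {}"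

definition additive_energy :: "'a::ab_group_add set \<Rightarrow> nat" where
  "additive_energy A =
     card {(a1, a2, a3, a4). a1 \<in> A \<and> a2 \<in> A \<and> a3 \<in> A \<and> a4 \<in> A \<and> a1 + a2 = a3 + a4}"

(* The infix minus on sets is set difference, so the difference set gets its own name. *)
definition difference_set :: "'a::ab_group_add set \<Rightarrow> 'a set \<Rightarrow> 'a set" where
  "difference_set X Y = {x - y | x y. x \<in> X \<and> y \<in> Y}"

end

theory Submission
  imports Defs
begin

text \<open>
  Write $r(d)$ for the number of representations of $d$ as a difference of two elements of $A$,
  $A_d = A \cap (A + d)$, so that $|A_d| = r(d)$ and $E(A) = \sum_d r(d)^2$. Split the energy at
  $r(d) = K^{-1/2}|A|$.

  If the differences above the threshold carry a noticeable part of the energy, then for one of them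
  almost all pairs in $A_d$ have a popular difference. Keep the elements $b$ of $A_d$ for which $b - c$
  is popular for most $c \in A_d$; a difference $b - b' = (b - c) - (b' - c)$ then has many
  representations by four elements of $A$.

  Otherwise fix a suitable $a \in A$ and compare $b \in A$ with differences $e$ such that $a \in A_e$. The
  pair $(b, e)$ is good if $\sum_{c \in A_e} r(b - c)$, a lower bound for the number of representations of
  $b - e$ in the form $p - q + w$, is at least of order $r(e)|A|/K$. Drawing $b$ with weight $r(a - b)$ and
  $e$ with weight $r(e)^2$, almost all pairs are good, because the bad ones contribute little on average
  over $a$. As no relevant $r(a - b)$ exceeds $K^{-1/2}|A|$, some superlevel set of $r(a - \cdot)$ is as
  large as required and inherits this property. Two elements $b, b'$ that are good for most $e$ satisfy
  $b - b' = (b - e) - (b' - e)$, which yields many representations by six elements of $A$. The height of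
  the superlevel sets is truncated at a multiple of the mean of $r(a - b)$ under the weight
  $r(a - b)$; this balances the size of the set against the total weight of the $e$.
\<close>

section \<open>Counting differences and selecting subsets by averaging\<close>

lemma finite_difference_set: "finite X \<Longrightarrow> finite Y \<Longrightarrow> finite (difference_set X Y)"
proof -
  have "difference_set X Y = (\<lambda>(x, y). x - y) ` (X \<times> Y)"
    unfolding difference_set_def by auto
  then show "finite X \<Longrightarrow> finite Y \<Longrightarrow> ?thesis" by simp
qed

text \<open>Each difference \<open>x = b - b'\<close> equals \<open>(b - e) - (b' - e)\<close>, so
  the correlation of \<open>\<rho>\<close> with its translate by \<open>x\<close> is at least
  \<open>m\<close>, while all these correlations together are at most the square of the mass of
  \<open>\<rho>\<close>. It serves for \<open>rep A\<close> and for the convolution of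
  \<open>rep A\<close> with the indicator of \<open>A\<close>.\<close>

lemma card_difference_set_mult_le:
  fixes \<rho> :: "'a::ab_group_add \<Rightarrow> real"
  assumes "finite G" "\<And>g. 0 \<le> \<rho> g" "\<And>g. g \<notin> G \<Longrightarrow> \<rho> g = 0" "finite S"
    and m: "\<And>b b'. b \<in> S \<Longrightarrow> b' \<in> S \<Longrightarrow> \<exists>F. finite F \<and> m \<le> (\<Sum>e\<in>F. \<rho> (b - e) * \<rho> (b' - e))"
  shows "real (card (difference_set S S)) * m \<le> (\<Sum>g\<in>G. \<rho> g)\<^sup>2"
proof -
  let ?X = "difference_set S S"
  have sub: "(\<Sum>h\<in>H. \<rho> h) \<le> (\<Sum>g\<in>G. \<rho> g)" if "finite H" for H
  proof -
    have "(\<Sum>h\<in>H. \<rho> h) = (\<Sum>h\<in>H \<inter> G. \<rho> h)"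
      by (rule sum.mono_neutral_right) (use that assms(3) in auto)
    also have "\<dots> \<le> (\<Sum>g\<in>G. \<rho> g)"
      by (rule sum_mono2) (use assms(1,2) in auto)
    finally show ?thesis .
  qed
  have fX: "finite ?X" using assms(4) by (simp add: finite_difference_set)
  have low: "m \<le> (\<Sum>g\<in>G. \<rho> g * \<rho> (g - x))" if x: "x \<in> ?X" for x
  proof -
    obtain b b' where b: "b \<in> S" "b' \<in> S" "x = b - b'"
      using x unfolding difference_set_def by auto
    obtain F where F: "finite F" "m \<le> (\<Sum>e\<in>F. \<rho> (b - e) * \<rho> (b' - e))"
      using m b by blast
    have "(\<Sum>e\<in>F. \<rho> (b - e) * \<rho> (b' - e)) = (\<Sum>g\<in>(\<lambda>e. b - e) ` F. \<rho> g * \<rho> (g - x))"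
      by (subst sum.reindex) (auto simp: inj_on_def b(3))
    also have "\<dots> = (\<Sum>g\<in>(\<lambda>e. b - e) ` F \<inter> G. \<rho> g * \<rho> (g - x))"
      by (rule sum.mono_neutral_right) (use F assms(3) in auto)
    also have "\<dots> \<le> (\<Sum>g\<in>G. \<rho> g * \<rho> (g - x))"
      by (rule sum_mono2) (use assms(1,2) in auto)
    finally show ?thesis using F by simp
  qed
  have "real (card ?X) * m = (\<Sum>x\<in>?X. m)" by simp
  also have "\<dots> \<le> (\<Sum>x\<in>?X. \<Sum>g\<in>G. \<rho> g * \<rho> (g - x))"
    by (rule sum_mono) (rule low)
  also have "\<dots> = (\<Sum>g\<in>G. \<rho> g * (\<Sum>x\<in>?X. \<rho> (g - x)))"
    by (subst sum.swap) (simp add: sum_distrib_left)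
  also have "\<dots> \<le> (\<Sum>g\<in>G. \<rho> g * (\<Sum>g\<in>G. \<rho> g))"
  proof (intro sum_mono mult_left_mono assms(2))
    fix g
    have "(\<Sum>x\<in>?X. \<rho> (g - x)) = (\<Sum>h\<in>(\<lambda>x. g - x) ` ?X. \<rho> h)"
      by (subst sum.reindex) (auto simp: inj_on_def)
    then show "(\<Sum>x\<in>?X. \<rho> (g - x)) \<le> (\<Sum>g\<in>G. \<rho> g)"
      using sub fX by simp
  qed
  also have "\<dots> = (\<Sum>g\<in>G. \<rho> g)\<^sup>2"
    by (simp add: sum_distrib_right power2_eq_square)
  finally show ?thesis .
qed

text \<open>By Markov's inequality, bad weight above a quarter of the total occurs for at most a
  fraction \<open>\<delta>\<close> of \<open>S\<close>. Two survivors together spoil at most half of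
  the weight.\<close>

lemma large_subset_of_pairwise_good:
  fixes \<psi> :: "'e \<Rightarrow> real" and B :: "'b \<Rightarrow> 'e \<Rightarrow> bool"
  assumes "finite S" "finite E" "\<And>e. e \<in> E \<Longrightarrow> 0 \<le> \<psi> e" and T: "0 < (\<Sum>e\<in>E. \<psi> e)"
    and bad: "(\<Sum>b\<in>S. \<Sum>e | e \<in> E \<and> B b e. \<psi> e) \<le> \<delta> / 4 * real (card S) * (\<Sum>e\<in>E. \<psi> e)"
  obtains S' where "S' \<subseteq> S" "real (card S') \<ge> (1 - \<delta>) * real (card S)"
    "\<And>b b'. b \<in> S' \<Longrightarrow> b' \<in> S' \<Longrightarrow>
      (\<Sum>e | e \<in> E \<and> \<not> B b e \<and> \<not> B b' e. \<psi> e) \<ge> (\<Sum>e\<in>E. \<psi> e) / 2"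
proof -
  define T where "T = (\<Sum>e\<in>E. \<psi> e)"
  define g where "g b = (\<Sum>e | e \<in> E \<and> B b e. \<psi> e)" for b
  define S' where "S' = {b\<in>S. g b \<le> T / 4}"
  have g0: "0 \<le> g b" for b unfolding g_def by (rule sum_nonneg) (use assms in auto)
  have "real (card (S - S')) * (T / 4) = (\<Sum>b\<in>S - S'. T / 4)" by simp
  also have "\<dots> \<le> (\<Sum>b\<in>S - S'. g b)" by (rule sum_mono) (auto simp: S'_def)
  also have "\<dots> \<le> (\<Sum>b\<in>S. g b)" by (rule sum_mono2) (use assms g0 in auto)
  also have "\<dots> \<le> \<delta> / 4 * real (card S) * T" using bad unfolding g_def T_def .
  finally have "real (card (S - S')) * T \<le> \<delta> * real (card S) * T" by simp
  then have "real (card (S - S')) \<le> \<delta> * real (card S)"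
    using T unfolding T_def[symmetric] by simp
  moreover have "card (S - S') = card S - card S'" "card S' \<le> card S"
    using assms(1) by (auto simp: S'_def intro!: card_Diff_subset card_mono)
  ultimately have "real (card S') \<ge> (1 - \<delta>) * real (card S)"
    by (simp add: algebra_simps of_nat_diff)
  moreover have "(\<Sum>e | e \<in> E \<and> \<not> B b e \<and> \<not> B b' e. \<psi> e) \<ge> T / 2"
    if "b \<in> S'" "b' \<in> S'" for b b'
  proof -
    let ?G = "{e\<in>E. \<not> B b e \<and> \<not> B b' e}" and ?P = "{e\<in>E. B b e}" and ?Q = "{e\<in>E. B b' e}"
    have "E = ?G \<union> (?P \<union> ?Q)" by auto
    then have "T = sum \<psi> (?G \<union> (?P \<union> ?Q))" by (simp add: T_def)
    also have "\<dots> = sum \<psi> ?G + sum \<psi> (?P \<union> ?Q)"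
      by (rule sum.union_disjoint) (use assms in auto)
    also have "sum \<psi> (?P \<union> ?Q) \<le> sum \<psi> ?P + sum \<psi> ?Q"
      using sum.union_inter[of ?P ?Q \<psi>] sum_nonneg[of "?P \<inter> ?Q" \<psi>] assms by auto
    also have "sum \<psi> ?P + sum \<psi> ?Q \<le> T / 4 + T / 4"
      using that unfolding S'_def g_def by (intro add_mono) auto
    finally show ?thesis by simp
  qed
  ultimately show ?thesis
    using that[of S'] unfolding T_def by (auto simp: S'_def)
qed

text \<open>
  A maximiser of the surplus of the sum over the threshold costs can lose neither a point nor an edge
  class, which gives both lower bounds simultaneously.
\<close>
lemma stable_subpair:
  fixes w \<beta> :: "'e \<Rightarrow> real" and inc :: "'b \<Rightarrow> 'e \<Rightarrow> bool" and \<alpha> :: real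
  assumes "finite A" "finite D" "\<And>e. e \<in> D \<Longrightarrow> 0 \<le> \<beta> e"
    and big: "\<alpha> * real (card A) + (\<Sum>e\<in>D. \<beta> e) < (\<Sum>e\<in>D. w e * real (card {a\<in>A. inc a e}))"
  obtains A0 D0 where "A0 \<subseteq> A" "D0 \<subseteq> D" "A0 \<noteq> {}"
    "\<And>a. a \<in> A0 \<Longrightarrow> \<alpha> \<le> (\<Sum>e | e \<in> D0 \<and> inc a e. w e)"
    "\<And>e. e \<in> D0 \<Longrightarrow> \<beta> e \<le> w e * real (card {a\<in>A0. inc a e})"
proof -
  define F where "F = (\<lambda>(X, Y). (\<Sum>e\<in>Y. w e * real (card {a\<in>X. inc a e}) - \<beta> e) - \<alpha> * real (card X))"
  \<comment> \<open>The same surplus grouped by points instead of edge classes: deleting a point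
    then removes one summand, as deleting a class does in the defining form.\<close>
  have F': "F (X, Y) = (\<Sum>a\<in>X. (\<Sum>e | e \<in> Y \<and> inc a e. w e) - \<alpha>) - (\<Sum>e\<in>Y. \<beta> e)"
    if "X \<subseteq> A" "Y \<subseteq> D" for X Y
  proof -
    have fin: "finite X" "finite Y" using that assms(1,2) finite_subset by blast+
    have "(\<Sum>a\<in>X. \<Sum>e | e \<in> Y \<and> inc a e. w e) = (\<Sum>e\<in>Y. \<Sum>a | a \<in> X \<and> inc a e. w e)"
      by (rule sum.swap_restrict) (use fin in auto)
    then show ?thesis
      by (simp add: F_def sum_subtractf mult.commute)
  qed
  have "finite (Pow A \<times> Pow D)" "Pow A \<times> Pow D \<noteq> {}" using assms by auto
  then obtain p where p: "p \<in> Pow A \<times> Pow D" "\<And>q. q \<in> Pow A \<times> Pow D \<Longrightarrow> F q \<le> F p"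
    using obtains_MAX[of "Pow A \<times> Pow D" F] Max_ge[of "F ` (Pow A \<times> Pow D)"] by (metis finite_imageI imageI)
  obtain A0 D0 where pe: "p = (A0, D0)" by (cases p)
  have sub: "A0 \<subseteq> A" "D0 \<subseteq> D" using p(1) pe by auto
  have fin: "finite A0" "finite D0" using sub assms(1,2) finite_subset by blast+
  have opt: "F (X, Y) \<le> F (A0, D0)" if "X \<subseteq> A" "Y \<subseteq> D" for X Y
    using p(2)[of "(X, Y)"] that pe by auto
  \<comment> \<open>Positivity passes to the maximiser and rules out an empty
    \<open>A0\<close>.\<close>
  have "0 < F (A, D)" using big by (simp add: F_def sum_subtractf)
  then have pos: "0 < F (A0, D0)" using opt[of A D] by simp
  show ?thesis
  proof (rule that[OF sub])
    show "A0 \<noteq> {}"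
    proof
      assume "A0 = {}"
      then have "F (A0, D0) = - (\<Sum>e\<in>D0. \<beta> e)" by (simp add: F_def sum_negf)
      moreover have "0 \<le> (\<Sum>e\<in>D0. \<beta> e)" by (rule sum_nonneg) (use sub assms in auto)
      ultimately show False using pos by simp
    qed
  next
    fix a assume a: "a \<in> A0"
    have "F (A0 - {a}, D0) \<le> F (A0, D0)" by (rule opt) (use sub in auto)
    then show "\<alpha> \<le> (\<Sum>e | e \<in> D0 \<and> inc a e. w e)"
      using a fin sub by (subst (asm) (1 2) F') (auto simp: sum_diff1)
  next
    fix e assume e: "e \<in> D0"
    have "F (A0, D0 - {e}) \<le> F (A0, D0)" by (rule opt) (use sub in auto)
    then show "\<beta> e \<le> w e * real (card {a\<in>A0. inc a e})"
      using e fin by (simp add: F_def sum_diff1)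
  qed
qed

section \<open>Superlevel sets of an integer weight\<close>

text \<open>Layer-cake summation: \<open>b\<close> lies in exactly \<open>min (f b) n\<close> of the
  superlevel sets at heights 1 to \<open>n\<close>.\<close>

lemma sum_card_superlevel:
  fixes f :: "'b \<Rightarrow> nat" and g :: "'b \<Rightarrow> real"
  assumes "finite N"
  shows "(\<Sum>u=1..n. \<Sum>b | b \<in> N \<and> u \<le> f b. g b) = (\<Sum>b\<in>N. real (min (f b) n) * g b)"
proof -
  have "(\<Sum>u=1..n. \<Sum>b | b \<in> N \<and> u \<le> f b. g b) = (\<Sum>b\<in>N. \<Sum>u | u \<in> {1..n} \<and> u \<le> f b. g b)"
    by (rule sum.swap_restrict) (use assms in auto)
  also have "\<dots> = (\<Sum>b\<in>N. real (min (f b) n) * g b)"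
  proof (rule sum.cong[OF refl])
    fix b
    have "{u. u \<in> {1..n} \<and> u \<le> f b} = {1..min (f b) n}" by auto
    then show "(\<Sum>u | u \<in> {1..n} \<and> u \<le> f b. g b) = real (min (f b) n) * g b" by simp
  qed
  finally show ?thesis .
qed

text \<open>The sizes of the superlevel sets add up to almost \<open>\<kappa>\<close>, so one among
  \<open>n\<close> of them has size about \<open>\<kappa> / n\<close>, and averaging size and
  \<open>g\<close>-mass jointly keeps the latter small. A large \<open>n\<close> costs size but
  forces \<open>T N\<close> to be large in proportion.\<close>

lemma large_superlevel_set:
  fixes f :: "'b \<Rightarrow> nat" and g :: "'b \<Rightarrow> real" and \<kappa> \<epsilon> s :: real
  defines "T \<equiv> \<lambda>N. \<Sum>b\<in>N. real (f b) ^ 2"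
  assumes "finite N" and \<kappa>: "0 < \<kappa>" and \<epsilon>: "0 < \<epsilon>" "\<epsilon> < 1"
    and R: "(1 - \<epsilon> / 4) * \<kappa> \<le> (\<Sum>b\<in>N. real (f b))"
    and s: "\<And>b. b \<in> N \<Longrightarrow> real (f b) \<le> s"
    and g0: "\<And>b. b \<in> N \<Longrightarrow> 0 \<le> g b"
    and g: "(\<Sum>b\<in>N. real (f b) * g b) \<le> \<epsilon>\<^sup>2 / 64 * \<kappa> * T N"
  obtains n u :: nat where "1 \<le> n" "real n \<le> s" "real n * \<kappa> * \<epsilon> / 8 \<le> T N"
    "(1 - \<epsilon> / 2) * \<kappa> / real n \<le> real (card {b\<in>N. u \<le> f b})"
    "(\<Sum>b | b \<in> N \<and> u \<le> f b. g b) \<le> \<epsilon> / 8 * real (card {b\<in>N. u \<le> f b}) * T N"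
proof -
  define T0 where "T0 = T N"
  define z where "z = 8 * T0 / (\<epsilon> * \<kappa>)"
  \<comment> \<open>Above \<open>z\<close> the values of \<open>f\<close> contribute at most \<open>T0 / z = \<epsilon> * \<kappa> / 8\<close> to the sum of \<open>f\<close>.\<close>
  define n where "n = nat \<lfloor>min z s\<rfloor>"
  \<comment> \<open>As \<open>f\<close> takes integer values, \<open>f b \<le> f b ^ 2\<close>. This
    yields \<open>1 \<le> z\<close>, and with \<open>1 \<le> s\<close> the rounded height
    \<open>n\<close> is positive.\<close>
  have RT: "(\<Sum>b\<in>N. real (f b)) \<le> T0"
    unfolding T0_def T_def
  proof (rule sum_mono)
    fix b
    have "f b \<le> f b ^ 2" by (simp add: power2_eq_square)
    then show "real (f b) \<le> real (f b) ^ 2" by (metis of_nat_le_iff of_nat_power)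
  qed
  have R0: "0 < (1 - \<epsilon> / 4) * \<kappa>" using \<kappa> \<epsilon> by simp
  then have T0: "0 < T0" using R RT by linarith
  have z1: "1 \<le> z"
  proof -
    have "\<epsilon> * \<kappa> \<le> 1 * \<kappa>" using \<epsilon> \<kappa> by (intro mult_right_mono) auto
    also have "\<dots> \<le> 8 * ((1 - \<epsilon> / 4) * \<kappa>)" using \<epsilon> \<kappa> by (simp add: algebra_simps)
    also have "\<dots> \<le> 8 * T0" using R RT by linarith
    finally show ?thesis unfolding z_def using \<epsilon> \<kappa> by simp
  qed
  have s1: "1 \<le> s"
  proof -
    have "\<exists>b\<in>N. f b \<noteq> 0"
    proof (rule ccontr)
      assume "\<not> ?thesis"
      then have "(\<Sum>b\<in>N. real (f b)) = 0" by simp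
      then show False using R R0 by linarith
    qed
    then obtain b where "b \<in> N" "f b \<noteq> 0" by blast
    then show ?thesis using s[of b] by linarith
  qed
  have n1: "1 \<le> n" unfolding n_def using z1 s1 by (simp add: le_nat_iff le_floor_iff)
  have n: "real n \<le> min z s" unfolding n_def using z1 s1 of_int_floor_le[of "min z s"] by simp
  have trunc: "real (f b) - real (min (f b) n) \<le> real (f b) ^ 2 * (\<epsilon> * \<kappa> / (8 * T0))"
    if b: "b \<in> N" for b
  proof (cases "f b \<le> n")
    case True then show ?thesis using \<epsilon> \<kappa> T0 by simp
  next
    case False
    \<comment> \<open>No value of \<open>f\<close> exceeds \<open>s\<close>, so a value above the
      rounded minimum of \<open>z\<close> and \<open>s\<close> must exceed \<open>z\<close>.\<close>
    have "z < real (f b)"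
    proof (rule ccontr)
      assume "\<not> z < real (f b)"
      then have "real (f b) \<le> min z s" using s[OF b] by simp
      then have "f b \<le> n" unfolding n_def by (simp add: le_nat_iff le_floor_iff)
      then show False using False by simp
    qed
    then have "1 \<le> real (f b) * (\<epsilon> * \<kappa> / (8 * T0))"
      unfolding z_def using \<epsilon> \<kappa> T0 by (simp add: field_simps)
    then have "real (f b) * 1 \<le> real (f b) * (real (f b) * (\<epsilon> * \<kappa> / (8 * T0)))"
      by (intro mult_left_mono) auto
    then show ?thesis by (simp add: power2_eq_square)
  qed
  let ?c = "\<lambda>u. real (card {b\<in>N. u \<le> f b})" and ?g = "\<lambda>u. \<Sum>b | b \<in> N \<and> u \<le> f b. g b"
  have "(\<Sum>b\<in>N. real (f b)) - (\<Sum>b\<in>N. real (min (f b) n)) \<le> (\<Sum>b\<in>N. real (f b) ^ 2 * (\<epsilon> * \<kappa> / (8 * T0)))"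
    unfolding sum_subtractf[symmetric] by (rule sum_mono) (rule trunc)
  also have "\<dots> = T0 * (\<epsilon> * \<kappa> / (8 * T0))" by (simp only: T0_def T_def sum_distrib_right)
  also have "\<dots> = \<epsilon> / 8 * \<kappa>" using T0 by simp
  finally have "(1 - \<epsilon> / 4 - \<epsilon> / 8) * \<kappa> \<le> (\<Sum>b\<in>N. real (min (f b) n))"
    using R by (simp add: algebra_simps)
  then have c: "(1 - \<epsilon> / 4 - \<epsilon> / 8) * \<kappa> \<le> (\<Sum>u=1..n. ?c u)"
    using sum_card_superlevel[OF assms(2), where g = "\<lambda>_. 1" and f = f and n = n] by simp
  have "(\<Sum>u=1..n. ?g u) = (\<Sum>b\<in>N. real (min (f b) n) * g b)"
    by (rule sum_card_superlevel[OF assms(2)])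
  also have "\<dots> \<le> (\<Sum>b\<in>N. real (f b) * g b)"
    by (intro sum_mono mult_right_mono g0) auto
  also have "\<dots> \<le> \<epsilon>\<^sup>2 / 64 * \<kappa> * T0" using g by (simp add: T0_def)
  \<comment> \<open>This factor prices the \<open>g\<close>-mass so that its total costs at most
    \<open>\<epsilon> / 8 * \<kappa>\<close>; with the losses \<open>\<epsilon> / 4\<close> from
    \<open>R\<close> and \<open>\<epsilon> / 8\<close> from truncation this makes
    \<open>\<epsilon> / 2\<close>.\<close>
  finally have "8 / (\<epsilon> * T0) * (\<Sum>u=1..n. ?g u) \<le> 8 / (\<epsilon> * T0) * (\<epsilon>\<^sup>2 / 64 * \<kappa> * T0)"
    by (rule mult_left_mono) (use \<epsilon> T0 in simp)
  also have "\<dots> = \<epsilon> / 8 * \<kappa>" using \<epsilon> T0 by (simp add: power2_eq_square)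
  finally have "(1 - \<epsilon> / 2) * \<kappa> \<le> (\<Sum>u=1..n. ?c u) - 8 / (\<epsilon> * T0) * (\<Sum>u=1..n. ?g u)"
    using c by (simp add: left_diff_distrib)
  then have tot: "(1 - \<epsilon> / 2) * \<kappa> \<le> (\<Sum>u=1..n. ?c u - 8 / (\<epsilon> * T0) * ?g u)"
    by (simp only: sum_subtractf sum_distrib_left)
  \<comment> \<open>Some level reaches the average of size minus cost. Since the cost and the
    average are both nonnegative, this one inequality gives the bound on the size and the bound on
    \<open>g\<close>.\<close>
  have "\<exists>u\<in>{1..n}. (1 - \<epsilon> / 2) * \<kappa> / real n \<le> ?c u - 8 / (\<epsilon> * T0) * ?g u"
  proof (rule ccontr)
    assume "\<not> ?thesis"
    then have "(\<Sum>u=1..n. ?c u - 8 / (\<epsilon> * T0) * ?g u) < (\<Sum>u=1..n. (1 - \<epsilon> / 2) * \<kappa> / real n)"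
      using n1 by (intro sum_strict_mono) (auto simp: not_le)
    then show False using tot n1 by simp
  qed
  then obtain u where u: "(1 - \<epsilon> / 2) * \<kappa> / real n \<le> ?c u - 8 / (\<epsilon> * T0) * ?g u" by blast
  have gu: "0 \<le> ?g u" by (rule sum_nonneg) (use g0 in auto)
  have "0 \<le> 8 / (\<epsilon> * T0) * ?g u" using gu \<epsilon> T0 by simp
  moreover have "0 \<le> (1 - \<epsilon> / 2) * \<kappa> / real n" using \<epsilon> \<kappa> by simp
  ultimately have "(1 - \<epsilon> / 2) * \<kappa> / real n \<le> ?c u" "8 / (\<epsilon> * T0) * ?g u \<le> ?c u"
    using u by linarith+
  moreover have "real n * \<kappa> * \<epsilon> / 8 \<le> T0"
    using n \<epsilon> \<kappa> unfolding z_def by (simp add: field_simps)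
  ultimately show ?thesis
    using that[of n u] n1 n \<epsilon> T0 unfolding T0_def[symmetric] by (simp add: field_simps)
qed

section \<open>Representation counts of differences and the energy\<close>

definition rep :: "'a::ab_group_add set \<Rightarrow> 'a \<Rightarrow> nat" where
  "rep A d = card {a\<in>A. a - d \<in> A}"

lemma diff_in_difference_set [intro]: "x \<in> X \<Longrightarrow> y \<in> Y \<Longrightarrow> x - y \<in> difference_set X Y"
  unfolding difference_set_def by blast

lemma rep_eq_0: "d \<notin> difference_set A A \<Longrightarrow> rep A d = 0"
proof -
  assume d: "d \<notin> difference_set A A"
  have "{a\<in>A. a - d \<in> A} = {}"
  proof (intro equals0I, clarsimp)
    fix a assume "a \<in> A" "a - d \<in> A"
    then have "a - (a - d) \<in> difference_set A A" by blast
    then show False using d by simp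
  qed
  then show ?thesis unfolding rep_def by (simp only: card.empty)
qed

lemma rep_minus_commute: "rep A (a - b) = rep A (b - a)"
  unfolding rep_def
  by (rule bij_betw_same_card[of "\<lambda>c. c - (a - b)"], rule bij_betw_byWitness[of _ "\<lambda>c. c + (a - b)"])
     (auto simp: algebra_simps)

lemma sum_differences_reindex:
  fixes h :: "'a::ab_group_add \<Rightarrow> real"
  shows "(\<Sum>e | e \<in> D \<and> a - e \<in> A. h e) = (\<Sum>b | b \<in> A \<and> a - b \<in> D. h (a - b))"
  by (rule sum.reindex_bij_witness[of _ "\<lambda>b. a - b" "\<lambda>e. a - e"]) auto

text \<open>Pairs of elements of \<open>A\<close> are grouped by their difference. Taking
  \<open>h\<close> constant 1 gives the mass of \<open>rep A\<close>, and \<open>h = rep A\<close>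
  gives the energy.\<close>

lemma sum_mult_rep:
  fixes h :: "'a::ab_group_add \<Rightarrow> real"
  assumes "finite A"
  shows "(\<Sum>d\<in>difference_set A A. h d * real (rep A d)) = (\<Sum>a\<in>A. \<Sum>b\<in>A. h (a - b))"
proof -
  let ?G = "difference_set A A"
  have "(\<Sum>d\<in>?G. h d * real (rep A d)) = (\<Sum>d\<in>?G. \<Sum>a | a \<in> A \<and> a - d \<in> A. h d)"
    by (simp add: rep_def mult.commute)
  also have "\<dots> = (\<Sum>a\<in>A. \<Sum>d | d \<in> ?G \<and> a - d \<in> A. h d)"
    by (rule sum.swap_restrict) (use assms in \<open>auto simp: finite_difference_set\<close>)
  also have "\<dots> = (\<Sum>a\<in>A. \<Sum>b\<in>A. h (a - b))"
    unfolding sum_differences_reindex[of _ ?G _ A]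
    by (intro sum.cong refl) auto
  finally show ?thesis .
qed

lemma sum_rep:
  assumes "finite A"
  shows "(\<Sum>d\<in>difference_set A A. real (rep A d)) = real (card A) ^ 2"
  using sum_mult_rep[OF assms, of "\<lambda>_. 1"] by (simp add: power2_eq_square)

text \<open>The equation \<open>a1 + a2 = a3 + a4\<close> says \<open>a1 - a3 = a4 - a2\<close>, so
  a quadruple is a pair \<open>(a1, a3)\<close> together with an \<open>a4\<close> such that
  \<open>a4 - (a1 - a3)\<close> lies in \<open>A\<close>.\<close>

lemma additive_energy_eq_sum_rep:
  fixes A :: "'a::ab_group_add set"
  assumes "finite A"
  shows "real (additive_energy A) = (\<Sum>d\<in>difference_set A A. real (rep A d) ^ 2)"
proof -
  let ?S = "SIGMA p:A \<times> A. {c\<in>A. c - (fst p - snd p) \<in> A}"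
  have eq: "a4 - (a1 - a3) = a2" if "a1 + a2 = a3 + a4" for a1 a2 a3 a4 :: 'a
    using that by (simp add: algebra_simps)
  have "additive_energy A = card ?S"
    unfolding additive_energy_def
    by (rule bij_betw_same_card[of "\<lambda>(a1, a2, a3, a4). ((a1, a3), a4)"],
        rule bij_betw_byWitness[of _ "\<lambda>((a1, a3), a4). (a1, a4 - (a1 - a3), a3, a4)"])
       (auto simp: eq)
  also have "\<dots> = (\<Sum>p\<in>A \<times> A. rep A (fst p - snd p))"
    unfolding rep_def by (rule card_SigmaI) (use assms in auto)
  also have "\<dots> = (\<Sum>a\<in>A. \<Sum>b\<in>A. rep A (a - b))"
    by (simp add: sum.cartesian_product case_prod_beta)
  finally show ?thesis
    using sum_mult_rep[OF assms, of "\<lambda>d. real (rep A d)"] by (simp add: power2_eq_square)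
qed

text \<open>Each such \<open>d\<close> gives a different representation
  \<open>(a - d) - (b - d)\<close> of \<open>a - b\<close>.\<close>

lemma card_common_translates_le:
  assumes "finite A"
  shows "card {d\<in>D. a - d \<in> A \<and> b - d \<in> A} \<le> rep A (a - b)"
  unfolding rep_def
  by (rule card_inj_on_le[of "\<lambda>d. a - d"]) (use assms in \<open>auto simp: inj_on_def algebra_simps\<close>)

section \<open>Energy carried by popular differences\<close>

lemma small_difference_set_of_large_popularity:
  fixes A :: "'a::ab_group_add set" and K \<epsilon> :: real
  defines "N \<equiv> real (card A)"
  defines "D \<equiv> {d\<in>difference_set A A. N / sqrt K < real (rep A d)}"
  assumes A: "finite A" "A \<noteq> {}" and K: "K \<ge> 1" and \<epsilon>: "0 < \<epsilon>" "\<epsilon> < 1/2"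
    and E: "\<epsilon> / 16 * (N ^ 3 / K) \<le> (\<Sum>d\<in>D. real (rep A d) ^ 2)"
  shows "\<exists>A'\<subseteq>A. (1 - \<epsilon>) * (N / sqrt K) \<le> real (card A') \<and>
    real (card (difference_set A' A')) \<le> 2 ^ 14 / \<epsilon> ^ 4 * K ^ 3 * real (card A')"
proof -
  have N: "0 < N" unfolding N_def using A by (simp add: card_gt_0_iff)
  \<comment> \<open>Chosen so that \<open>N\<^sup>2 * t\<close> is \<open>\<epsilon> / 4\<close>
    times the lower bound \<open>\<epsilon> / 16 * (N ^ 3 / K)\<close> in \<open>E\<close>.\<close>
  define t where "t = \<epsilon>\<^sup>2 / 64 * N / K"
  have t: "0 < t" unfolding t_def using N K \<epsilon> by simp
  define S where "S d = {a\<in>A. a - d \<in> A}" for d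
  define bad where "bad d = (\<Sum>a\<in>S d. \<Sum>b | b \<in> S d \<and> real (rep A (a - b)) < t. 1::real)" for d
  have fS: "finite (S d)" for d unfolding S_def using A by simp
  have cS: "card (S d) = rep A d" for d unfolding S_def rep_def ..
  have fD: "finite D" unfolding D_def using A by (simp add: finite_difference_set)
  have E0: "0 < \<epsilon> / 16 * (N ^ 3 / K)" using N K \<epsilon> by simp
  have Dne: "D \<noteq> {}" using E E0 by auto
  \<comment> \<open>Count by pairs instead: a pair \<open>(a, b)\<close> lies in at most
    \<open>rep A (a - b)\<close> of the sets \<open>S d\<close>, which is below \<open>t\<close> for
    every pair counted as bad.\<close>
  have "(\<Sum>d\<in>D. bad d) = (\<Sum>d\<in>D. \<Sum>p | p \<in> A \<times> A \<and>
      (fst p - d \<in> A \<and> snd p - d \<in> A \<and> real (rep A (fst p - snd p)) < t). 1)"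
  proof (rule sum.cong[OF refl])
    fix d
    have "bad d = (\<Sum>p\<in>(SIGMA a:S d. {b\<in>S d. real (rep A (a - b)) < t}). 1)"
      unfolding bad_def by (subst sum.Sigma) (use fS in auto)
    also have "(SIGMA a:S d. {b\<in>S d. real (rep A (a - b)) < t}) = {p\<in>A \<times> A.
      fst p - d \<in> A \<and> snd p - d \<in> A \<and> real (rep A (fst p - snd p)) < t}"
      unfolding S_def by auto
    finally show "bad d = (\<Sum>p | p \<in> A \<times> A \<and>
      (fst p - d \<in> A \<and> snd p - d \<in> A \<and> real (rep A (fst p - snd p)) < t). 1)" .
  qed
  also have "\<dots> = (\<Sum>p\<in>A \<times> A. \<Sum>d | d \<in> D \<and>
      (fst p - d \<in> A \<and> snd p - d \<in> A \<and> real (rep A (fst p - snd p)) < t). 1)"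
    by (rule sum.swap_restrict) (use fD A in auto)
  also have "\<dots> \<le> (\<Sum>p\<in>A \<times> A. t)"
  proof (rule sum_mono)
    fix p
    show "(\<Sum>d | d \<in> D \<and>
      (fst p - d \<in> A \<and> snd p - d \<in> A \<and> real (rep A (fst p - snd p)) < t). 1) \<le> t"
    proof (cases "real (rep A (fst p - snd p)) < t")
      case True
      then show ?thesis
        using card_common_translates_le[OF A(1), of D "fst p" "snd p"] by simp
    qed (use t in simp)
  qed
  also have "\<dots> = \<epsilon>\<^sup>2 / 64 * (N ^ 3 / K)"
    by (simp add: t_def N_def power3_eq_cube card_cartesian_product)
  finally have bad: "(\<Sum>d\<in>D. bad d) \<le> \<epsilon>\<^sup>2 / 64 * (N ^ 3 / K)" .
  have "\<exists>d\<in>D. bad d \<le> \<epsilon> / 4 * real (rep A d) ^ 2"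
  proof (rule ccontr)
    assume "\<not> ?thesis"
    then have "(\<Sum>d\<in>D. \<epsilon> / 4 * real (rep A d) ^ 2) < (\<Sum>d\<in>D. bad d)"
      using fD Dne by (intro sum_strict_mono) (auto simp: not_le)
    then have "\<epsilon> / 4 * (\<Sum>d\<in>D. real (rep A d) ^ 2) < \<epsilon>\<^sup>2 / 64 * (N ^ 3 / K)"
      using bad by (simp add: sum_distrib_left)
    moreover have "\<epsilon> / 4 * (\<epsilon> / 16 * (N ^ 3 / K)) \<le> \<epsilon> / 4 * (\<Sum>d\<in>D. real (rep A d) ^ 2)"
      by (rule mult_left_mono[OF E]) (use \<epsilon> in simp)
    ultimately show False by (simp add: power2_eq_square)
  qed
  then obtain d where d: "d \<in> D" "bad d \<le> \<epsilon> / 4 * real (rep A d) ^ 2" by blast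
  have dN: "N / sqrt K < real (rep A d)" using d(1) unfolding D_def by simp
  have rd: "0 < real (rep A d)" using dN N K by (smt (verit) divide_pos_pos real_sqrt_gt_zero)
  obtain S' where S': "S' \<subseteq> S d" "(1 - \<epsilon>) * real (card (S d)) \<le> real (card S')"
    and good: "\<And>b b'. b \<in> S' \<Longrightarrow> b' \<in> S' \<Longrightarrow>
      (\<Sum>c | c \<in> S d \<and> \<not> real (rep A (b - c)) < t \<and> \<not> real (rep A (b' - c)) < t. 1::real)
        \<ge> (\<Sum>c\<in>S d. 1) / 2"
  proof (rule large_subset_of_pairwise_good[of "S d" "S d" "\<lambda>_. 1" "\<lambda>b c. real (rep A (b - c)) < t" \<epsilon>])
    show "(\<Sum>b\<in>S d. \<Sum>e | e \<in> S d \<and> real (rep A (b - e)) < t. 1) \<le>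
        \<epsilon> / 4 * real (card (S d)) * (\<Sum>e\<in>S d. 1)"
      using d(2) unfolding bad_def cS[symmetric] by (simp add: power2_eq_square)
  qed (use fS rd cS in auto)
  have "real (card (difference_set S' S')) * (real (rep A d) / 2 * t\<^sup>2)
      \<le> (\<Sum>g\<in>difference_set A A. real (rep A g))\<^sup>2"
  proof (rule card_difference_set_mult_le)
    show "finite S'" using S'(1) fS finite_subset by blast
    fix b b' assume b: "b \<in> S'" "b' \<in> S'"
    let ?F = "{c\<in>S d. \<not> real (rep A (b - c)) < t \<and> \<not> real (rep A (b' - c)) < t}"
    have "real (rep A d) / 2 * t\<^sup>2 \<le> (\<Sum>c\<in>?F. 1) * t\<^sup>2"
      using good[OF b] cS by (intro mult_right_mono) auto
    also have "\<dots> = (\<Sum>c\<in>?F. t * t)" by (simp add: power2_eq_square)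
    also have "\<dots> \<le> (\<Sum>c\<in>?F. real (rep A (b - c)) * real (rep A (b' - c)))"
      by (intro sum_mono mult_mono) (use t in auto)
    finally show "\<exists>F. finite F \<and>
      real (rep A d) / 2 * t\<^sup>2 \<le> (\<Sum>e\<in>F. real (rep A (b - e)) * real (rep A (b' - e)))"
      using fS by (intro exI[of _ ?F]) auto
  qed (use A in \<open>auto simp: finite_difference_set rep_eq_0\<close>)
  also have "\<dots> = N ^ 4" unfolding sum_rep[OF A(1)] N_def by simp
  finally have count: "real (card (difference_set S' S')) * (real (rep A d) / 2 * t\<^sup>2) \<le> N ^ 4" .
  define X where "X = real (card (difference_set S' S'))"
  define r where "r = real (rep A d)"
  \<comment> \<open>The factor \<open>t\<^sup>2\<close> in \<open>count\<close> costs
    \<open>K\<^sup>2\<close>. Trading the remaining \<open>N\<^sup>2\<close> for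
    \<open>r\<^sup>2 * K\<close> costs a third \<open>K\<close>; then one \<open>r\<close> cancels
    and the other is at most \<open>2 * real (card S')\<close>.\<close>
  have "N \<le> r * sqrt K" using dN K unfolding r_def by (simp add: field_simps)
  then have "N\<^sup>2 \<le> (r * sqrt K)\<^sup>2" using N by (intro power_mono) auto
  then have N2: "N\<^sup>2 \<le> r\<^sup>2 * K" using K by (simp add: power_mult_distrib)
  have r2: "r \<le> 2 * real (card S')"
  proof -
    have "1/2 * r \<le> (1 - \<epsilon>) * r" using \<epsilon> rd r_def by (intro mult_right_mono) auto
    then show ?thesis using S'(2) cS r_def by simp
  qed
  have t2: "K\<^sup>2 * t\<^sup>2 = \<epsilon> ^ 4 * N\<^sup>2 / 2 ^ 12"
    unfolding t_def using K by (simp add: power_mult_distrib power_divide flip: power_mult)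
  have "(X * r * \<epsilon> ^ 4) * N\<^sup>2 = 2 ^ 13 * (X * (r / 2 * (\<epsilon> ^ 4 * N\<^sup>2 / 2 ^ 12)))" by simp
  also have "\<dots> = 2 ^ 13 * K\<^sup>2 * (X * (r / 2 * t\<^sup>2))" 
    unfolding t2[symmetric] by (simp only: mult_ac times_divide_eq_left times_divide_eq_right)
  also have "\<dots> \<le> 2 ^ 13 * K\<^sup>2 * N ^ 4"
    using count unfolding X_def r_def by (intro mult_left_mono) auto
  also have "\<dots> = (2 ^ 13 * K\<^sup>2 * N\<^sup>2) * N\<^sup>2" by (simp add: power_add[symmetric])
  finally have "(X * r * \<epsilon> ^ 4) * N\<^sup>2 \<le> (2 ^ 13 * K\<^sup>2 * N\<^sup>2) * N\<^sup>2" .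
  then have "X * r * \<epsilon> ^ 4 \<le> 2 ^ 13 * K\<^sup>2 * N\<^sup>2" by (rule mult_right_le_imp_le) (use N in simp)
  also have "\<dots> \<le> 2 ^ 13 * K\<^sup>2 * (r\<^sup>2 * K)" using N2 K by (intro mult_left_mono) auto
  also have "\<dots> = (2 ^ 13 * K ^ 3 * r) * r" by (simp add: power2_eq_square power3_eq_cube)
  finally have "(X * \<epsilon> ^ 4) * r \<le> (2 ^ 13 * K ^ 3 * r) * r" by (simp only: mult_ac)
  then have "X * \<epsilon> ^ 4 \<le> 2 ^ 13 * K ^ 3 * r" by (rule mult_right_le_imp_le) (use rd r_def in simp)
  also have "\<dots> \<le> 2 ^ 13 * K ^ 3 * (2 * real (card S'))" using r2 K by (intro mult_left_mono) auto
  finally have "X \<le> 2 ^ 14 / \<epsilon> ^ 4 * K ^ 3 * real (card S')" using \<epsilon> by (simp add: field_simps)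
  moreover have "(1 - \<epsilon>) * (N / sqrt K) \<le> (1 - \<epsilon>) * r"
    using dN \<epsilon> unfolding r_def by (intro mult_left_mono) auto
  then have "(1 - \<epsilon>) * (N / sqrt K) \<le> real (card S')" using S'(2) cS r_def by simp
  moreover have "S' \<subseteq> A" using S'(1) unfolding S_def by auto
  ultimately show ?thesis unfolding X_def by (intro exI[of _ S'] conjI)
qed

section \<open>Energy carried by unpopular differences\<close>

text \<open>Here \<open>\<rho> t\<close> counts the triples from \<open>A\<close> with
  \<open>t = p - q + w\<close>, so its mass is bounded by the number of all triples.\<close>

lemma sum_rep_convolution_le:
  fixes A :: "'a::ab_group_add set"
  assumes "finite A"
  defines "\<rho> \<equiv> \<lambda>t. \<Sum>w\<in>A. real (rep A (t - w))"
  obtains G where "finite G" "\<And>g. g \<notin> G \<Longrightarrow> \<rho> g = 0" "(\<Sum>g\<in>G. \<rho> g) \<le> real (card A) ^ 3"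
proof -
  define G where "G = (\<lambda>(d, w). d + w) ` (difference_set A A \<times> A)"
  have fD: "finite (difference_set A A)" using assms(1) by (simp add: finite_difference_set)
  have G: "finite G" unfolding G_def using assms fD by simp
  have z: "\<rho> g = 0" if "g \<notin> G" for g
    unfolding \<rho>_def
  proof (rule sum.neutral, rule ballI)
    fix w assume w: "w \<in> A"
    have "g - w \<notin> difference_set A A"
    proof
      assume "g - w \<in> difference_set A A"
      then have "(g - w) + w \<in> G" unfolding G_def using w by force
      then show False using that by simp
    qed
    then show "real (rep A (g - w)) = 0" by (simp add: rep_eq_0)
  qed
  have "(\<Sum>g\<in>G. \<rho> g) = (\<Sum>w\<in>A. \<Sum>g\<in>G. real (rep A (g - w)))"
    unfolding \<rho>_def by (rule sum.swap)
  also have "\<dots> \<le> (\<Sum>w\<in>A. real (card A) ^ 2)"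
  proof (rule sum_mono)
    fix w
    have "(\<Sum>g\<in>G. real (rep A (g - w))) = (\<Sum>d\<in>(\<lambda>g. g - w) ` G. real (rep A d))"
      by (subst sum.reindex) (auto simp: inj_on_def)
    also have "\<dots> = (\<Sum>d\<in>(\<lambda>g. g - w) ` G \<inter> difference_set A A. real (rep A d))"
      by (rule sum.mono_neutral_right) (use G in \<open>auto simp: rep_eq_0\<close>)
    also have "\<dots> \<le> (\<Sum>d\<in>difference_set A A. real (rep A d))"
      by (rule sum_mono2) (use fD in auto)
    finally show "(\<Sum>g\<in>G. real (rep A (g - w))) \<le> real (card A) ^ 2"
      using sum_rep[OF assms(1)] by simp
  qed
  also have "\<dots> = real (card A) ^ 3" by (simp add: power2_eq_square power3_eq_cube)
  finally have "(\<Sum>g\<in>G. \<rho> g) \<le> real (card A) ^ 3" .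
  then show ?thesis using that[of G] G z by blast
qed

lemma small_difference_set_of_small_popularity:
  fixes A :: "'a::ab_group_add set" and K \<epsilon> :: real
  defines "N \<equiv> real (card A)"
  defines "D \<equiv> {d\<in>difference_set A A. real (rep A d) \<le> N / sqrt K}"
  assumes A: "finite A" "A \<noteq> {}" and K: "K \<ge> 1" and \<epsilon>: "0 < \<epsilon>" "\<epsilon> < 1/2"
    and E: "(1 - \<epsilon> / 16) * (N ^ 3 / K) \<le> (\<Sum>d\<in>D. real (rep A d) ^ 2)"
  shows "\<exists>A'\<subseteq>A. (1 - \<epsilon>) * (N / sqrt K) \<le> real (card A') \<and>
    real (card (difference_set A' A')) \<le> 2 ^ 23 / \<epsilon> ^ 7 * K ^ 4 * real (card A')"
proof -
  define r where "r d = real (rep A d)" for d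
  have r0: "0 \<le> r d" for d by (simp add: r_def)
  have N: "0 < N" unfolding N_def using A by (simp add: card_gt_0_iff)
  define \<kappa> where "\<kappa> = N\<^sup>2 / K"
  have \<kappa>: "0 < \<kappa>" unfolding \<kappa>_def using N K by simp
  have \<kappa>N: "\<kappa> * N = N ^ 3 / K" unfolding \<kappa>_def by (simp add: power2_eq_square power3_eq_cube)
  have fD: "finite D" unfolding D_def using A by (simp add: finite_difference_set)
  have cr: "real (card {a\<in>A. a - e \<in> A}) = r e" for e by (simp add: r_def rep_def)
  \<comment> \<open>There is room because the losses \<open>\<epsilon> / 16\<close> and
    \<open>\<epsilon> / 8\<close> add up to less than \<open>\<epsilon> / 4\<close>.\<close>
  have big: "(1 - \<epsilon> / 4) * \<kappa> * real (card A) + (\<Sum>e\<in>D. \<epsilon> / 8 * (r e)\<^sup>2)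
      < (\<Sum>e\<in>D. r e * real (card {a\<in>A. a - e \<in> A}))"
  proof -
    define Q where "Q = (\<Sum>e\<in>D. (r e)\<^sup>2)"
    have Q: "(1 - \<epsilon> / 16) * (\<kappa> * N) \<le> Q" using E unfolding Q_def r_def \<kappa>N .
    have "(1 - \<epsilon> / 4) < (1 - \<epsilon> / 8) * (1 - \<epsilon> / 16)" using \<epsilon> by (simp add: algebra_simps add_pos_pos)
    then have "(1 - \<epsilon> / 4) * (\<kappa> * N) < (1 - \<epsilon> / 8) * (1 - \<epsilon> / 16) * (\<kappa> * N)"
      using \<kappa> N by (intro mult_strict_right_mono) auto
    also have "\<dots> = (1 - \<epsilon> / 8) * ((1 - \<epsilon> / 16) * (\<kappa> * N))" by simp
    also have "\<dots> \<le> (1 - \<epsilon> / 8) * Q" using Q \<epsilon> by (intro mult_left_mono) auto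
    finally have "(1 - \<epsilon> / 4) * \<kappa> * N + \<epsilon> / 8 * Q < Q" by (simp add: algebra_simps)
    then show ?thesis
      unfolding cr Q_def N_def by (simp add: sum_distrib_left power2_eq_square)
  qed
  obtain A0 D0 where A0: "A0 \<subseteq> A" "A0 \<noteq> {}" and D0: "D0 \<subseteq> D"
    and rich: "\<And>a. a \<in> A0 \<Longrightarrow> (1 - \<epsilon> / 4) * \<kappa> \<le> (\<Sum>e | e \<in> D0 \<and> a - e \<in> A. r e)"
    and dense: "\<And>e. e \<in> D0 \<Longrightarrow> \<epsilon> / 8 * (r e)\<^sup>2 \<le> r e * real (card {a\<in>A0. a - e \<in> A})"
    by (rule stable_subpair[OF A(1) fD _ big]) (use \<epsilon> in auto)
  have fA0: "finite A0" using A0 A finite_subset by blast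
  have fD0: "finite D0" using D0 fD finite_subset by blast
  define T where "T a = (\<Sum>e | e \<in> D0 \<and> a - e \<in> A. (r e)\<^sup>2)" for a
  define P where "P b e = (\<Sum>c | c \<in> A \<and> c - e \<in> A. r (b - c))" for b e
  \<comment> \<open>Chosen so that \<open>N * t\<close> is the product of
    \<open>\<epsilon>\<^sup>2 / 64 * \<kappa>\<close>, the tolerance for bad weight, and
    \<open>\<epsilon> / 8\<close>, the density of the classes in \<open>A0\<close>.\<close>
  define t where "t = \<epsilon> ^ 3 / 2 ^ 9 * N / K"
  have t: "0 < t" unfolding t_def using \<epsilon> N K by simp
  define bad where "bad b e \<longleftrightarrow> P b e < t * r e" for b e
  define g where "g a b = (\<Sum>e | e \<in> {e\<in>D0. a - e \<in> A} \<and> bad b e. (r e)\<^sup>2)" for a b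
  have g0: "0 \<le> g a b" for a b unfolding g_def by (rule sum_nonneg) auto
  \<comment> \<open>Density in \<open>A0\<close> bounds the total of \<open>T a\<close> below by the
    third moment of \<open>r\<close> over \<open>D0\<close>, the quantity that also controls the bad
    weight.\<close>
  have Tsum: "\<epsilon> / 8 * (\<Sum>e\<in>D0. r e ^ 3) \<le> (\<Sum>a\<in>A0. T a)"
  proof -
    have "(\<Sum>a\<in>A0. T a) = (\<Sum>e\<in>D0. \<Sum>a | a \<in> A0 \<and> a - e \<in> A. (r e)\<^sup>2)"
      unfolding T_def by (rule sum.swap_restrict[OF fA0 fD0])
    also have "\<dots> = (\<Sum>e\<in>D0. r e * (r e * real (card {a\<in>A0. a - e \<in> A})))"
      by (simp add: power2_eq_square mult_ac)
    also have "\<dots> \<ge> (\<Sum>e\<in>D0. r e * (\<epsilon> / 8 * (r e)\<^sup>2))"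
      by (intro sum_mono mult_left_mono dense r0)
    finally show ?thesis by (simp add: sum_distrib_left power2_eq_square power3_eq_cube mult_ac)
  qed
  \<comment> \<open>For fixed \<open>b\<close> and \<open>e\<close>, summing
    \<open>r (a - b)\<close> over the \<open>a\<close> incident to \<open>e\<close> gives
    \<open>P b e\<close>, because \<open>r\<close> is even. A bad pair thus contributes at most
    \<open>t * r e ^ 3\<close>.\<close>
  have badsum: "(\<Sum>a\<in>A0. \<Sum>b\<in>A. r (a - b) * g a b) \<le> (\<Sum>a\<in>A0. \<epsilon>\<^sup>2 / 64 * \<kappa> * T a)"
  proof -
    have "(\<Sum>a\<in>A0. \<Sum>b\<in>A. r (a - b) * g a b) \<le> (\<Sum>a\<in>A. \<Sum>b\<in>A. r (a - b) * g a b)"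
      by (rule sum_mono2) (use A A0 r0 g0 in \<open>auto intro!: sum_nonneg\<close>)
    also have "\<dots> = (\<Sum>b\<in>A. \<Sum>a\<in>A. r (a - b) * g a b)" by (rule sum.swap)
    also have "\<dots> \<le> (\<Sum>b\<in>A. \<Sum>e\<in>D0. t * r e ^ 3)"
    proof (rule sum_mono)
      fix b assume "b \<in> A"
      have "(\<Sum>a\<in>A. r (a - b) * g a b) = (\<Sum>a\<in>A. \<Sum>e | e \<in> D0 \<and> (a - e \<in> A \<and> bad b e). r (a - b) * (r e)\<^sup>2)"
        unfolding g_def by (simp add: sum_distrib_left)
      also have "\<dots> = (\<Sum>e\<in>D0. \<Sum>a | a \<in> A \<and> (a - e \<in> A \<and> bad b e). r (a - b) * (r e)\<^sup>2)"
        by (rule sum.swap_restrict[OF A(1) fD0])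
      also have "\<dots> \<le> (\<Sum>e\<in>D0. t * r e ^ 3)"
      proof (rule sum_mono)
        fix e
        show "(\<Sum>a | a \<in> A \<and> (a - e \<in> A \<and> bad b e). r (a - b) * (r e)\<^sup>2) \<le> t * r e ^ 3"
        proof (cases "bad b e")
          case True
          then have "(\<Sum>a | a \<in> A \<and> (a - e \<in> A \<and> bad b e). r (a - b) * (r e)\<^sup>2) = P b e * (r e)\<^sup>2"
            unfolding P_def r_def by (simp add: rep_minus_commute[of A b] sum_distrib_right)
          also have "\<dots> \<le> (t * r e) * (r e)\<^sup>2"
            using True unfolding bad_def by (intro mult_right_mono) auto
          finally show ?thesis by (simp add: power2_eq_square power3_eq_cube mult_ac)
        qed (use t r0 in simp)
      qed
      finally show "(\<Sum>a\<in>A. r (a - b) * g a b) \<le> (\<Sum>e\<in>D0. t * r e ^ 3)" .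
    qed
    also have "\<dots> = N * (t * (\<Sum>e\<in>D0. r e ^ 3))"
      by (simp only: N_def sum_distrib_left[symmetric] sum_constant mult.left_commute)
    also have "\<dots> = \<epsilon>\<^sup>2 / 64 * \<kappa> * (\<epsilon> / 8 * (\<Sum>e\<in>D0. r e ^ 3))"
      by (simp add: t_def \<kappa>_def power2_eq_square power3_eq_cube)
    also have "\<dots> \<le> \<epsilon>\<^sup>2 / 64 * \<kappa> * (\<Sum>a\<in>A0. T a)"
      using Tsum \<kappa> by (intro mult_left_mono) auto
    finally show ?thesis by (simp add: sum_distrib_left)
  qed
  have "\<exists>a\<in>A0. (\<Sum>b\<in>A. r (a - b) * g a b) \<le> \<epsilon>\<^sup>2 / 64 * \<kappa> * T a"
  proof (rule ccontr)
    assume "\<not> ?thesis"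
    then have "(\<Sum>a\<in>A0. \<epsilon>\<^sup>2 / 64 * \<kappa> * T a) < (\<Sum>a\<in>A0. \<Sum>b\<in>A. r (a - b) * g a b)"
      using fA0 A0(2) by (intro sum_strict_mono) (auto simp: not_le)
    then show False using badsum by simp
  qed
  then obtain a where a: "a \<in> A0" and ga: "(\<Sum>b\<in>A. r (a - b) * g a b) \<le> \<epsilon>\<^sup>2 / 64 * \<kappa> * T a"
    by blast
  \<comment> \<open>Under \<open>e = a - b\<close>, the total weight \<open>T a\<close> of the
    classes through \<open>a\<close> is also the second moment of \<open>r (a - b)\<close> over
    \<open>M\<close>, which lets the superlevel bound control it.\<close>
  define M where "M = {b\<in>A. a - b \<in> D0}"
  have fM: "finite M" unfolding M_def using A by simp
  have TM: "(\<Sum>b\<in>M. real (rep A (a - b)) ^ 2) = T a"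
    unfolding T_def M_def sum_differences_reindex[of _ D0 a A] r_def ..
  obtain n u where n: "1 \<le> n" "real n \<le> N / sqrt K" "real n * \<kappa> * \<epsilon> / 8 \<le> T a"
    and S: "(1 - \<epsilon> / 2) * \<kappa> / real n \<le> real (card {b\<in>M. u \<le> rep A (a - b)})"
      "(\<Sum>b | b \<in> M \<and> u \<le> rep A (a - b). g a b) \<le> \<epsilon> / 8 * real (card {b\<in>M. u \<le> rep A (a - b)}) * T a"
  proof (rule large_superlevel_set[of M \<kappa> \<epsilon> "\<lambda>b. rep A (a - b)" "N / sqrt K" "g a", unfolded TM])
    show "(1 - \<epsilon> / 4) * \<kappa> \<le> (\<Sum>b\<in>M. real (rep A (a - b)))"
      using rich[OF a] unfolding sum_differences_reindex[of _ D0 a A] M_def r_def .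
    show "real (rep A (a - b)) \<le> N / sqrt K" if "b \<in> M" for b
      using that D0 unfolding M_def D_def by auto
    have "(\<Sum>b\<in>M. r (a - b) * g a b) \<le> (\<Sum>b\<in>A. r (a - b) * g a b)"
      by (rule sum_mono2) (use A r0 g0 in \<open>auto simp: M_def\<close>)
    then show "(\<Sum>b\<in>M. real (rep A (a - b)) * g a b) \<le> \<epsilon>\<^sup>2 / 64 * \<kappa> * T a"
      using ga unfolding r_def by simp
  qed (use fM \<kappa> \<epsilon> g0 in auto)
  define S where "S = {b\<in>M. u \<le> rep A (a - b)}"
  note S = S[folded S_def]
  have fS: "finite S" and SA: "S \<subseteq> A" unfolding S_def using A by (auto simp: M_def)
  have T0: "0 < T a"
  proof -
    have "0 < real n * \<kappa> * \<epsilon> / 8" using n \<kappa> \<epsilon> by simp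
    then show ?thesis using n(3) by linarith
  qed
  let ?E = "{e\<in>D0. a - e \<in> A}"
  \<comment> \<open>Passing to the superlevel set and passing to \<open>S'\<close> each lose a
    factor \<open>1 - \<epsilon> / 2\<close>, together at most
    \<open>1 - \<epsilon>\<close>.\<close>
  obtain S' where S': "S' \<subseteq> S" "(1 - \<epsilon> / 2) * real (card S) \<le> real (card S')"
    and good: "\<And>b b'. b \<in> S' \<Longrightarrow> b' \<in> S' \<Longrightarrow>
      (\<Sum>e | e \<in> ?E \<and> \<not> bad b e \<and> \<not> bad b' e. (r e)\<^sup>2) \<ge> (\<Sum>e\<in>?E. (r e)\<^sup>2) / 2"
  proof (rule large_subset_of_pairwise_good[of S ?E "\<lambda>e. (r e)\<^sup>2" bad "\<epsilon> / 2"])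
    show "(\<Sum>b\<in>S. \<Sum>e | e \<in> ?E \<and> bad b e. (r e)\<^sup>2) \<le> \<epsilon> / 2 / 4 * real (card S) * (\<Sum>e\<in>?E. (r e)\<^sup>2)"
      using S(2) unfolding T_def g_def S_def by simp
    show "0 < (\<Sum>e\<in>?E. (r e)\<^sup>2)" using T0 unfolding T_def .
  qed (use fS fD0 in auto)
  define \<rho> where "\<rho> x = (\<Sum>w\<in>A. real (rep A (x - w)))" for x
  have P\<rho>: "P b e \<le> \<rho> (b - e)" for b e
  proof -
    have "P b e = (\<Sum>w\<in>(\<lambda>c. c - e) ` {c\<in>A. c - e \<in> A}. r (b - e - w))"
      unfolding P_def by (subst sum.reindex) (auto simp: inj_on_def)
    also have "\<dots> \<le> (\<Sum>w\<in>A. r (b - e - w))"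
      by (rule sum_mono2) (use A r0 in auto)
    finally show ?thesis unfolding \<rho>_def r_def .
  qed
  obtain G where G: "finite G" "\<And>g. g \<notin> G \<Longrightarrow> \<rho> g = 0" "(\<Sum>g\<in>G. \<rho> g) \<le> N ^ 3"
    using sum_rep_convolution_le[OF A(1)] unfolding \<rho>_def N_def by metis
  have \<rho>0: "0 \<le> \<rho> x" for x unfolding \<rho>_def by (rule sum_nonneg) auto
  have "real (card (difference_set S' S')) * (t\<^sup>2 * (T a / 2)) \<le> (\<Sum>g\<in>G. \<rho> g)\<^sup>2"
  proof (rule card_difference_set_mult_le[OF G(1) \<rho>0 G(2)])
    show "finite S'" using S'(1) fS finite_subset by blast
    fix b b' assume b: "b \<in> S'" "b' \<in> S'"
    let ?F = "{e\<in>?E. \<not> bad b e \<and> \<not> bad b' e}"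
    have "t\<^sup>2 * (T a / 2) \<le> t\<^sup>2 * (\<Sum>e\<in>?F. (r e)\<^sup>2)"
      using good[OF b] unfolding T_def by (intro mult_left_mono) auto
    also have "\<dots> = (\<Sum>e\<in>?F. (t * r e) * (t * r e))"
      by (simp add: sum_distrib_left power2_eq_square mult_ac)
    also have "\<dots> \<le> (\<Sum>e\<in>?F. \<rho> (b - e) * \<rho> (b' - e))"
    proof (intro sum_mono mult_mono \<rho>0)
      fix e assume "e \<in> ?F"
      then have "t * r e \<le> P b e" "t * r e \<le> P b' e" unfolding bad_def by auto
      then show "t * r e \<le> \<rho> (b - e)" "t * r e \<le> \<rho> (b' - e)" using P\<rho> order_trans by blast+
      show "0 \<le> t * r e" using t r0 by simp
    qed
    finally show "\<exists>F. finite F \<and> t\<^sup>2 * (T a / 2) \<le> (\<Sum>e\<in>F. \<rho> (b - e) * \<rho> (b' - e))"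
      using fD0 by (intro exI[of _ ?F]) auto
  qed
  also have "\<dots> \<le> (N ^ 3)\<^sup>2" by (rule power_mono[OF G(3)]) (use \<rho>0 in \<open>auto intro: sum_nonneg\<close>)
  finally have count: "real (card (difference_set S' S')) * (t\<^sup>2 * (T a / 2)) \<le> (N ^ 3)\<^sup>2" .
  define X where "X = real (card (difference_set S' S'))"
  define s where "s = real (card S')"
  have X0: "0 \<le> X" unfolding X_def by simp
  have size: "(1 - \<epsilon>) * (\<kappa> / real n) \<le> s"
  proof -
    have "(1 - \<epsilon>) * (\<kappa> / real n) \<le> (1 - \<epsilon> / 2) * (1 - \<epsilon> / 2) * (\<kappa> / real n)"
      using \<kappa> \<epsilon> by (intro mult_right_mono) (auto simp: algebra_simps)
    also have "\<dots> = (1 - \<epsilon> / 2) * ((1 - \<epsilon> / 2) * \<kappa> / real n)" by simp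
    also have "\<dots> \<le> (1 - \<epsilon> / 2) * real (card S)" using S(1) \<epsilon> by (intro mult_left_mono) auto
    finally show ?thesis using S'(2) unfolding s_def by linarith
  qed
  have "1/2 * (\<kappa> / real n) \<le> (1 - \<epsilon>) * (\<kappa> / real n)"
    using \<epsilon> \<kappa> by (intro mult_right_mono) auto
  \<comment> \<open>The height \<open>n\<close> cancels here: \<open>s\<close> is at least
    \<open>\<kappa> / (2 * n)\<close> and \<open>T a\<close> at least
    \<open>n * \<kappa> * \<epsilon> / 8\<close>, so their product has a lower bound free of
    \<open>n\<close>.\<close>
  then have "\<kappa> \<le> 2 * s * real n" using size n(1) by (simp add: field_simps)
  then have "\<kappa> * (\<kappa> * \<epsilon>) \<le> 2 * s * real n * (\<kappa> * \<epsilon>)" using \<kappa> \<epsilon> by (intro mult_right_mono) auto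
  also have "\<dots> = 16 * s * (real n * \<kappa> * \<epsilon> / 8)" by simp
  also have "\<dots> \<le> 16 * s * T a" using n(3) by (intro mult_left_mono) (auto simp: s_def)
  finally have Ts: "\<kappa>\<^sup>2 * \<epsilon> \<le> 16 * s * T a" by (simp add: power2_eq_square)
  have "X * t\<^sup>2 * (\<kappa>\<^sup>2 * \<epsilon>) \<le> X * t\<^sup>2 * (16 * s * T a)" using Ts X0 by (intro mult_left_mono) auto
  also have "\<dots> = 32 * s * (X * (t\<^sup>2 * (T a / 2)))" by simp
  also have "\<dots> \<le> 32 * s * (N ^ 3)\<^sup>2"
    using count unfolding X_def by (intro mult_left_mono) (auto simp: s_def)
  finally have le: "X * t\<^sup>2 * (\<kappa>\<^sup>2 * \<epsilon>) \<le> 32 * s * N ^ 6" by (simp flip: power_mult)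
  \<comment> \<open>The exponent 4 of \<open>K\<close> arises as two from \<open>t\<^sup>2\<close>
    and two from \<open>\<kappa>\<^sup>2\<close>.\<close>
  have tk: "K ^ 4 * (t\<^sup>2 * \<kappa>\<^sup>2) = \<epsilon> ^ 6 * N ^ 6 / 2 ^ 18"
    unfolding t_def \<kappa>_def using K
    by (simp add: power_mult_distrib power_divide power_add[symmetric] flip: power_mult)
  have "(X * \<epsilon> ^ 7) * N ^ 6 = 2 ^ 18 * X * \<epsilon> * (\<epsilon> ^ 6 * N ^ 6 / 2 ^ 18)"
    using power_Suc[of \<epsilon> 6] by simp
  also have "\<dots> = 2 ^ 18 * K ^ 4 * (X * t\<^sup>2 * (\<kappa>\<^sup>2 * \<epsilon>))" unfolding tk[symmetric] by (simp only: mult_ac)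
  also have "\<dots> \<le> 2 ^ 18 * K ^ 4 * (32 * s * N ^ 6)" using le by (intro mult_left_mono) auto
  finally have "(X * \<epsilon> ^ 7) * N ^ 6 \<le> (2 ^ 23 * K ^ 4 * s) * N ^ 6" by simp
  then have "X * \<epsilon> ^ 7 \<le> 2 ^ 23 * K ^ 4 * s" by (rule mult_right_le_imp_le) (use N in simp)
  then have "X \<le> 2 ^ 23 / \<epsilon> ^ 7 * K ^ 4 * s" using \<epsilon> by (simp add: field_simps)
  \<comment> \<open>Unpopularity enters through \<open>n \<le> N / sqrt K\<close>: as
    \<open>\<kappa>\<close> is the square of \<open>N / sqrt K\<close>, the quotient
    \<open>\<kappa> / n\<close> is at least \<open>N / sqrt K\<close>.\<close>
  moreover have "(1 - \<epsilon>) * (N / sqrt K) \<le> s"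
  proof -
    have "N / sqrt K * real n \<le> N / sqrt K * (N / sqrt K)"
      using n(2) N K by (intro mult_left_mono) auto
    also have "\<dots> = \<kappa>" using K by (simp add: \<kappa>_def power2_eq_square)
    finally have "N / sqrt K \<le> \<kappa> / real n" using n(1) by (simp add: field_simps)
    then have "(1 - \<epsilon>) * (N / sqrt K) \<le> (1 - \<epsilon>) * (\<kappa> / real n)"
      using \<epsilon> by (intro mult_left_mono) auto
    then show ?thesis using size by linarith
  qed
  moreover have "S' \<subseteq> A" using S'(1) SA by auto
  ultimately show ?thesis unfolding X_def s_def by (intro exI[of _ S'] conjI)
qed

section \<open>Splitting the energy and combining the two cases\<close>

theorem theorem1p2:
  fixes K \<epsilon> :: real and A :: "'a::ab_group_add set"
  assumes "K \<ge> 1"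
    and "0 < \<epsilon>" and "\<epsilon> < 1/2"
    and "additive_set A"
    and "real (additive_energy A) \<ge> real (card A) ^ 3 / K"
  shows "\<exists>A'\<subseteq>A.
    real (card A') \<ge> (1 - \<epsilon>) * K powr (-1/2) * real (card A) \<and>
    real (card (difference_set A' A')) \<le> 2 ^ 33 * \<epsilon> powi (-9) * K ^ 4 * real (card A')"
proof -
  have A: "finite A" "A \<noteq> {}" using assms(4) unfolding additive_set_def by auto
  define N where "N = real (card A)"
  define G where "G = difference_set A A"
  have fG: "finite G" unfolding G_def using A by (simp add: finite_difference_set)
  define D1 where "D1 = {d\<in>G. N / sqrt K < real (rep A d)}"
  define D2 where "D2 = {d\<in>G. real (rep A d) \<le> N / sqrt K}"
  have "(\<Sum>d\<in>G. real (rep A d) ^ 2) = (\<Sum>d\<in>D1. real (rep A d) ^ 2) + (\<Sum>d\<in>D2. real (rep A d) ^ 2)"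
    by (subst sum.union_disjoint[symmetric]) (use fG in \<open>auto simp: D1_def D2_def intro: sum.cong\<close>)
  then have tot: "N ^ 3 / K \<le> (\<Sum>d\<in>D1. real (rep A d) ^ 2) + (\<Sum>d\<in>D2. real (rep A d) ^ 2)"
    using assms(5) additive_energy_eq_sum_rep[OF A(1)] unfolding N_def G_def by simp
  \<comment> \<open>A share \<open>\<epsilon> / 16\<close> of the energy suffices for the popular
    case; otherwise the unpopular differences carry the rest. Both bounds are weakened to a common
    one by \<open>\<epsilon> < 1\<close> and \<open>1 \<le> K\<close>.\<close>
  have "\<exists>A'\<subseteq>A. (1 - \<epsilon>) * (N / sqrt K) \<le> real (card A') \<and>
    real (card (difference_set A' A')) \<le> 2 ^ 33 / \<epsilon> ^ 9 * K ^ 4 * real (card A')"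
  proof (cases "\<epsilon> / 16 * (N ^ 3 / K) \<le> (\<Sum>d\<in>D1. real (rep A d) ^ 2)")
    case True
    have "\<epsilon> ^ 9 \<le> \<epsilon> ^ 4" "K ^ 3 \<le> K ^ 4"
      using assms(1-3) by (auto intro: power_decreasing power_increasing)
    then have "2 ^ 14 / \<epsilon> ^ 4 * K ^ 3 \<le> 2 ^ 33 / \<epsilon> ^ 9 * K ^ 4"
      using assms(1,2) by (intro mult_mono frac_le) auto
    then have "2 ^ 14 / \<epsilon> ^ 4 * K ^ 3 * real m \<le> 2 ^ 33 / \<epsilon> ^ 9 * K ^ 4 * real m" for m
      by (rule mult_right_mono) simp
    then show ?thesis
      using small_difference_set_of_large_popularity[OF A assms(1-3)] True unfolding D1_def N_def G_def
      by (meson order_trans)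
  next
    case False
    then have "(1 - \<epsilon> / 16) * (N ^ 3 / K) \<le> (\<Sum>d\<in>D2. real (rep A d) ^ 2)"
      using tot by (simp only: left_diff_distrib)
    moreover have "\<epsilon> ^ 9 \<le> \<epsilon> ^ 7"
      using assms(2,3) by (auto intro: power_decreasing)
    then have "2 ^ 23 / \<epsilon> ^ 7 * K ^ 4 \<le> 2 ^ 33 / \<epsilon> ^ 9 * K ^ 4"
      using assms(1,2) by (intro mult_right_mono frac_le) auto
    then have "2 ^ 23 / \<epsilon> ^ 7 * K ^ 4 * real m \<le> 2 ^ 33 / \<epsilon> ^ 9 * K ^ 4 * real m" for m
      by (rule mult_right_mono) simp
    ultimately show ?thesis
      using small_difference_set_of_small_popularity[OF A assms(1-3)] unfolding D2_def N_def G_def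
      by (meson order_trans)
  qed
  moreover have "K powr (-1/2) = 1 / sqrt K"
    using assms(1) by (simp add: powr_minus_divide powr_half_sqrt)
  moreover have "\<epsilon> powi (-9) = 1 / \<epsilon> ^ 9"
    by (simp add: power_int_def field_simps)
  ultimately show ?thesis unfolding N_def by simp
qed

end
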